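(* Let $\Gamma$ be a connected nonsingular locally finite graph with $\Gamma^1\neq\emptyset$, and let $v\in\Gamma^0$. The action of $\pi_1(\Gamma,v)$ on $v\partial X_\Gamma$ is topologically free if and only if $\Gamma$ is not a minimal cycle.
   Context: A graph $\Gamma=(\Gamma^0,\Gamma^1,r,s)$ consists of countable sets $\Gamma^0$ (vertices) and $\Gamma^1$ (edges), maps $r,s:\Gamma^1\to\Gamma^0$ (range, source), and a map $e\mapsto\overline e$ on $\Gamma^1$ with $\overline e\neq e$, $\overline{\overline e}=e$, $s(e)=r(\overline e)$. $\Gamma$ is locally finite if $|r^{-1}(x)|<\infty$ for all $x\in\Gamma^0$, and nonsingular if no vertex $x$ has $|r^{-1}(x)|=1$. A path of length $n\ge1$ is $e_1\cdots e_n$ with $s(e_i)=r(e_{i+1})$; its range is $r(e_1)$ and its source $s(e_n)$; vertices are paths of length $0$. It is reduced if $e_{i+1}\neq\overline{e_i}$ for all $i$. A minimal cycle is a reduced path $e_1\cdots e_n$ ($n\ge1$) with range equal to source and the vertices $r(e_i)$ pairwise distinct; "$\Gamma$ is a minimal cycle" means that $\Gamma^1=\{e_i,\overline{e_i}:1\le i\le n\}$ for such a path. $\Gamma$ is regarded as a graph of groups in which all vertex and edge groups are trivial. $\pi_1(\Gamma,v)$ is the group of reduced paths with range and source $v$, under concatenation followed by cancellation of subpaths $e\overline e$ (the usual fundamental group of the graph). $v\partial X_\Gamma$ is the set of infinite reduced paths $e_1e_2\cdots$ with $r(e_1)=v$, with the compact Hausdorff topology having as base the cylinder sets $Z(\mu)$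 of infinite reduced paths extending a finite reduced path $\mu$ with range $v$. $\pi_1(\Gamma,v)$ acts on $v\partial X_\Gamma$ by concatenation followed by cancellation. An action of a discrete group $\Lambda$ on a compact Hausdorff space $Y$ is topologically free if for each $t\in\Lambda\setminus\{1\}$ the set $\{y\in Y:ty\ne y\}$ is dense in $Y$. *)

theory Defs
  imports
    "HOL-Analysis.Abstract_Topology"
    "HOL-Algebra.Group_Action"
    "HOL-Library.Countable_Set"
    "HOL-Library.Omega_Words_Fun"
    "Graph_Theory.Graph_Theory"
begin

text \<open>
  A graph in the sense of Serre is a bidirected digraph: \<open>bar\<close> sends an edge to its inverse edge.
  (The locale also fixes the irrelevant values of \<open>bar\<close> outside the edge set.)
  The tail of an arc \<open>e\<close> is its range \<open>r(e)\<close> and the head is its source \<open>s(e)\<close>. A path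
  \<open>e\<^sub>1\<cdots>e\<^sub>n\<close> with \<open>s(e\<^sub>i) = r(e\<^sub>i\<^sub>+\<^sub>1)\<close>, range \<open>x\<close> and source \<open>y\<close> is thus an arc walk from \<open>x\<close> to \<open>y\<close>,
  and the edges with range \<open>x\<close> are the outgoing arcs of \<open>x\<close>. The path of length 0 at a vertex is
  the empty list, its vertex being given by the end points of the arc walk.
\<close>

definition locally_finite :: "('v, 'e) pre_digraph \<Rightarrow> bool" where
  "locally_finite G \<longleftrightarrow> (\<forall>x \<in> verts G. finite (out_arcs G x))"

definition nonsingular :: "('v, 'e) pre_digraph \<Rightarrow> bool" where
  "nonsingular G \<longleftrightarrow> (\<forall>x \<in> verts G. out_degree G x \<noteq> 1)"

definition reduced :: "('e \<Rightarrow> 'e) \<Rightarrow> 'e list \<Rightarrow> bool" where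
  "reduced bar p \<longleftrightarrow> successively (\<lambda>e f. f \<noteq> bar e) p"

definition reduced_path ::
    "('v, 'e) pre_digraph \<Rightarrow> ('e \<Rightarrow> 'e) \<Rightarrow> 'v \<Rightarrow> 'e list \<Rightarrow> 'v \<Rightarrow> bool" where
  "reduced_path G bar x p y \<longleftrightarrow> pre_digraph.awalk G x p y \<and> reduced bar p"

text \<open>\<open>pre_digraph.cycle\<close> demands a nonempty closed walk whose arcs have pairwise distinct tails.\<close>

definition minimal_cycle :: "('v, 'e) pre_digraph \<Rightarrow> ('e \<Rightarrow> 'e) \<Rightarrow> 'e list \<Rightarrow> bool" where
  "minimal_cycle G bar p \<longleftrightarrow> pre_digraph.cycle G p \<and> reduced bar p"

definition is_minimal_cycle :: "('v, 'e) pre_digraph \<Rightarrow> ('e \<Rightarrow> 'e) \<Rightarrow> bool" where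
  "is_minimal_cycle G bar \<longleftrightarrow> (\<exists>p. minimal_cycle G bar p \<and> arcs G = set p \<union> bar ` set p)"

text \<open>
  Concatenation followed by cancellation: the edges of the left factor are prepended one by one,
  starting with its last edge, and each one is cancelled if it meets its inverse.
\<close>

fun prepend :: "('e \<Rightarrow> 'e) \<Rightarrow> 'e \<Rightarrow> 'e list \<Rightarrow> 'e list" where
  "prepend bar e [] = [e]"
| "prepend bar e (f # p) = (if f = bar e then p else e # f # p)"

definition path_mult :: "('e \<Rightarrow> 'e) \<Rightarrow> 'e list \<Rightarrow> 'e list \<Rightarrow> 'e list" where
  "path_mult bar p q = foldr (prepend bar) p q"

definition fundamental_group ::
    "('v, 'e) pre_digraph \<Rightarrow> ('e \<Rightarrow> 'e) \<Rightarrow> 'v \<Rightarrow> 'e list monoid" where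
  "fundamental_group G bar v =
     \<lparr>carrier = {p. reduced_path G bar v p v}, monoid.mult = path_mult bar, one = []\<rparr>"

definition boundary :: "('v, 'e) pre_digraph \<Rightarrow> ('e \<Rightarrow> 'e) \<Rightarrow> 'v \<Rightarrow> 'e word set" where
  "boundary G bar v = {\<xi>. tail G (\<xi> 0) = v \<and>
     (\<forall>n. \<xi> n \<in> arcs G \<and> head G (\<xi> n) = tail G (\<xi> (Suc n)) \<and> \<xi> (Suc n) \<noteq> bar (\<xi> n))}"

definition cylinder ::
    "('v, 'e) pre_digraph \<Rightarrow> ('e \<Rightarrow> 'e) \<Rightarrow> 'v \<Rightarrow> 'e list \<Rightarrow> 'e word set" where
  "cylinder G bar v \<mu> = {\<xi> \<in> boundary G bar v. prefix (length \<mu>) \<xi> = \<mu>}"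

definition boundary_topology ::
    "('v, 'e) pre_digraph \<Rightarrow> ('e \<Rightarrow> 'e) \<Rightarrow> 'v \<Rightarrow> 'e word topology" where
  "boundary_topology G bar v =
     topology_generated_by {cylinder G bar v \<mu> | \<mu> w. reduced_path G bar v \<mu> w}"

definition prepend_inf :: "('e \<Rightarrow> 'e) \<Rightarrow> 'e \<Rightarrow> 'e word \<Rightarrow> 'e word" where
  "prepend_inf bar e \<xi> = (if \<xi> 0 = bar e then suffix 1 \<xi> else e ## \<xi>)"

text \<open>
  The action is restricted to the boundary because \<^locale>\<open>group_action\<close> asks for extensional maps.
\<close>

definition boundary_action ::
    "('v, 'e) pre_digraph \<Rightarrow> ('e \<Rightarrow> 'e) \<Rightarrow> 'v \<Rightarrow> 'e list \<Rightarrow> 'e word \<Rightarrow> 'e word" where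
  "boundary_action G bar v p = (\<lambda>\<xi> \<in> boundary G bar v. foldr (prepend_inf bar) p \<xi>)"

definition topologically_free ::
    "('g, 'm) monoid_scheme \<Rightarrow> 'y topology \<Rightarrow> ('g \<Rightarrow> 'y \<Rightarrow> 'y) \<Rightarrow> bool" where
  "topologically_free \<Lambda> Y \<phi> \<longleftrightarrow>
     (\<forall>t \<in> carrier \<Lambda> - {\<one>\<^bsub>\<Lambda>\<^esub>}. Y closure_of {y \<in> topspace Y. \<phi> t y \<noteq> y} = topspace Y)"


section \<open>Basic properties\<close>

lemma reduced_simps [simp]:
  "reduced bar []"
  "reduced bar [e]"
  "reduced bar (e # f # p) \<longleftrightarrow> f \<noteq> bar e \<and> reduced bar (f # p)"
  by (simp_all add: reduced_def)

lemma reduced_Cons: "reduced bar (e # p) \<longleftrightarrow> reduced bar p \<and> (p = [] \<or> hd p \<noteq> bar e)"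
  by (cases p) auto

lemma suffix_1_build [simp]: "suffix 1 (e ## \<xi>) = \<xi>"
  by (rule ext) simp

lemma build_suffix_1: "\<xi> 0 ## suffix 1 \<xi> = \<xi>"
proof
  fix n show "(\<xi> 0 ## suffix 1 \<xi>) n = \<xi> n" by (cases n) auto
qed

lemma path_mult_simps [simp]:
  "path_mult bar [] q = q"
  "path_mult bar (e # p) q = prepend bar e (path_mult bar p q)"
  by (simp_all add: path_mult_def)

lemma path_mult_append: "path_mult bar (p @ q) x = path_mult bar p (path_mult bar q x)"
  by (simp add: path_mult_def)

lemma path_mult_Nil: "reduced bar p \<Longrightarrow> path_mult bar p [] = p"
proof (induction p)
  case (Cons e p) then show ?case by (cases p) auto
qed simp

context bidirected_digraph
begin

text \<open>
  The product cancels exactly a final segment of the left factor against the inverse initial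
  segment of the right factor; what remains is reduced. The same holds for infinite paths.
\<close>

lemma path_mult_cancels:
  assumes "reduced arev p"
  shows "\<exists>a c b. p = a @ c \<and> q = map arev (rev c) @ b \<and> path_mult arev p q = a @ b"
  using assms
proof (induction p)
  case (Cons e p)
  then obtain a c b where IH: "p = a @ c" "q = map arev (rev c) @ b" "path_mult arev p q = a @ b"
    by (auto simp: reduced_Cons)
  show ?case
  proof (cases "a = [] \<and> b \<noteq> [] \<and> hd b = arev e")
    case True
    then obtain b' where "b = arev e # b'" by (cases b) auto
    with IH True have "e # p = [] @ (e # c)" "q = map arev (rev (e # c)) @ b'"
      "path_mult arev (e # p) q = [] @ b'"
      by auto
    then show ?thesis by blast
  next
    case False
    have "path_mult arev (e # p) q = (e # a) @ b"
    proof (cases a)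
      case Nil
      with False IH(3) show ?thesis by (cases b) auto
    next
      case (Cons f a')
      with IH \<open>reduced arev (e # p)\<close> show ?thesis by auto
    qed
    moreover have "e # p = (e # a) @ c" using IH(1) by simp
    ultimately show ?thesis using IH(2) by blast
  qed
qed simp

lemma prepend_inf_cancels:
  assumes "reduced arev p"
  shows "\<exists>a c b. p = a @ c \<and> \<xi> = map arev (rev c) \<frown> b \<and> foldr (prepend_inf arev) p \<xi> = a \<frown> b"
  using assms
proof (induction p)
  case Nil
  show ?case by (rule exI[of _ "[]"], rule exI[of _ "[]"], rule exI[of _ \<xi>]) simp
next
  case (Cons e p)
  then obtain a c b where IH: "p = a @ c" "\<xi> = map arev (rev c) \<frown> b"
      "foldr (prepend_inf arev) p \<xi> = a \<frown> b"
    by (auto simp: reduced_Cons)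
  have build: "e ## \<eta> = [e] \<frown> \<eta>" for e and \<eta> :: "'b word"
  proof
    fix n show "(e ## \<eta>) n = ([e] \<frown> \<eta>) n" by (cases n) (auto simp: conc_def)
  qed
  show ?case
  proof (cases "a = [] \<and> b 0 = arev e")
    case True
    then have b: "[arev e] \<frown> suffix 1 b = b" by (metis build build_suffix_1)
    have "map arev (rev (e # c)) \<frown> suffix 1 b = map arev (rev c) \<frown> [arev e] \<frown> suffix 1 b"
      by (simp only: conc_conc) simp
    also have "\<dots> = \<xi>" by (simp only: b IH(2))
    finally have "\<xi> = map arev (rev (e # c)) \<frown> suffix 1 b" ..
    moreover have "foldr (prepend_inf arev) (e # p) \<xi> = [] \<frown> suffix 1 b"
      using True IH(3) by (simp add: prepend_inf_def)
    moreover have "e # p = [] @ (e # c)" using IH(1) True by simp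
    ultimately show ?thesis
      by - (rule exI[of _ "[]"], rule exI[of _ "e # c"], rule exI[of _ "suffix 1 b"], intro conjI)
  next
    case False
    then have "(a \<frown> b) 0 \<noteq> arev e"
      using IH(1) \<open>reduced arev (e # p)\<close> by (cases a) (auto simp: conc_def)
    then have "foldr (prepend_inf arev) (e # p) \<xi> = [e] \<frown> (a \<frown> b)"
      using IH(3) by (simp only: foldr.simps o_apply prepend_inf_def if_False build)
    also have "\<dots> = (e # a) \<frown> b"
      by (simp only: conc_conc) simp
    finally have "foldr (prepend_inf arev) (e # p) \<xi> = (e # a) \<frown> b" .
    moreover have "e # p = (e # a) @ c" using IH(1) by simp
    ultimately show ?thesis using IH(2)
      by - (rule exI[of _ "e # a"], rule exI[of _ c], rule exI[of _ b], intro conjI)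
  qed
qed

lemma reduced_prepend: "reduced arev p \<Longrightarrow> reduced arev (prepend arev e p)"
  by (cases p) (auto simp: reduced_Cons)

lemma reduced_path_mult: "reduced arev q \<Longrightarrow> reduced arev (path_mult arev p q)"
  by (induction p) (auto intro: reduced_prepend)

lemma prepend_arev: "reduced arev p \<Longrightarrow> prepend arev e (prepend arev (arev e) p) = p"
  by (cases p; cases "tl p") (auto simp: reduced_Cons)

lemma path_mult_prepend:
  assumes "reduced arev q"
  shows "path_mult arev (prepend arev e p) q = prepend arev e (path_mult arev p q)"
proof (cases p)
  case (Cons f p')
  then show ?thesis
    using prepend_arev[OF reduced_path_mult[OF assms], of e p'] by auto
qed simp

lemma path_mult_assoc:
  "reduced arev x \<Longrightarrow>
    path_mult arev (path_mult arev p q) x = path_mult arev p (path_mult arev q x)"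
  by (induction p) (simp_all add: path_mult_prepend)

lemma awalk_prepend:
  "e \<in> arcs G \<Longrightarrow> awalk (head G e) p w \<Longrightarrow> awalk (tail G e) (prepend arev e p) w"
  by (cases p) (auto simp: awalk_Cons_iff awalk_Nil_iff)

lemma awalk_path_mult:
  "awalk u p v \<Longrightarrow> awalk v q w \<Longrightarrow> awalk u (path_mult arev p q) w"
  by (induction p arbitrary: u) (auto simp: awalk_Cons_iff awalk_Nil_iff intro: awalk_prepend)

lemma awalk_inverse: "awalk u p v \<Longrightarrow> awalk v (map arev (rev p)) u"
proof (induction p arbitrary: u)
  case (Cons e p)
  then have "e \<in> arcs G" "tail G e = u" "awalk v (map arev (rev p)) (head G e)"
    by (auto simp: awalk_Cons_iff)
  moreover from this have "awalk (head G e) [arev e] u"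
    by (auto simp: awalk_Cons_iff awalk_Nil_iff)
  ultimately show ?case by (simp add: awalk_appendI)
qed (simp add: awalk_Nil_iff)

lemma reduced_inverse: "reduced arev p \<Longrightarrow> reduced arev (map arev (rev p))"
  unfolding reduced_def successively_map successively_rev
  by (erule successively_mono) (metis arev_arev)

lemma path_mult_inverse: "path_mult arev (map arev (rev p)) p = []"
  by (induction p) (simp_all add: path_mult_append)

lemma group_fundamental_group:
  assumes "v \<in> verts G"
  shows "group (fundamental_group G arev v)"
proof (rule groupI)
  fix x assume "x \<in> carrier (fundamental_group G arev v)"
  then have x: "awalk v x v" "reduced arev x"
    by (auto simp: fundamental_group_def reduced_path_def)
  show "\<exists>y\<in>carrier (fundamental_group G arev v).
    y \<otimes>\<^bsub>fundamental_group G arev v\<^esub> x = \<one>\<^bsub>fundamental_group G arev v\<^esub>"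
    by (rule bexI[of _ "map arev (rev x)"])
      (auto simp: fundamental_group_def reduced_path_def x path_mult_inverse
        intro: awalk_inverse reduced_inverse)
qed (use assms in \<open>auto simp: fundamental_group_def reduced_path_def awalk_Nil_iff path_mult_assoc
      intro: awalk_path_mult reduced_path_mult\<close>)

lemma prepend_inf_boundary:
  assumes "e \<in> arcs G" "\<xi> \<in> boundary G arev (head G e)"
  shows "prepend_inf arev e \<xi> \<in> boundary G arev (tail G e)"
proof (cases "\<xi> 0 = arev e")
  case True
  then have "tail G (\<xi> 1) = tail G e"
    using assms by (auto simp: boundary_def) (metis head_arev)
  with True assms show ?thesis by (auto simp: boundary_def prepend_inf_def)
next
  case False
  have "(e ## \<xi>) n \<in> arcs G \<and> head G ((e ## \<xi>) n) = tail G ((e ## \<xi>) (Suc n)) \<and>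
      (e ## \<xi>) (Suc n) \<noteq> arev ((e ## \<xi>) n)" for n
    using assms False by (cases n) (auto simp: boundary_def)
  with False show ?thesis by (auto simp: boundary_def prepend_inf_def)
qed

lemma foldr_prepend_inf_boundary:
  "awalk u p v \<Longrightarrow> \<xi> \<in> boundary G arev v \<Longrightarrow> foldr (prepend_inf arev) p \<xi> \<in> boundary G arev u"
  by (induction p arbitrary: u) (auto simp: awalk_Cons_iff awalk_Nil_iff intro: prepend_inf_boundary)

lemma prepend_inf_arev:
  assumes "\<xi> 1 \<noteq> arev (\<xi> 0)"
  shows "prepend_inf arev e (prepend_inf arev (arev e) \<xi>) = \<xi>"
proof (cases "\<xi> 0 = e")
  case True
  with assms show ?thesis using build_suffix_1[of \<xi>] by (auto simp: prepend_inf_def)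
qed (use suffix_1_build in \<open>auto simp: prepend_inf_def\<close>)

lemma boundary_step: "\<xi> \<in> boundary G arev v \<Longrightarrow> \<xi> 1 \<noteq> arev (\<xi> 0)"
  by (auto simp: boundary_def)

lemma foldr_prepend_inf_prepend:
  assumes "awalk u p v" "\<xi> \<in> boundary G arev v"
  shows "foldr (prepend_inf arev) (prepend arev e p) \<xi> =
    prepend_inf arev e (foldr (prepend_inf arev) p \<xi>)"
proof (cases p)
  case (Cons f p')
  with assms(1) have "awalk (head G f) p' v" by (simp add: awalk_Cons_iff)
  from boundary_step[OF foldr_prepend_inf_boundary[OF this assms(2)]] Cons
  show ?thesis by (auto simp: prepend_inf_arev)
qed simp

lemma foldr_prepend_inf_path_mult:
  assumes "awalk u p v" "awalk v q w" "\<xi> \<in> boundary G arev w"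
  shows "foldr (prepend_inf arev) (path_mult arev p q) \<xi> =
    foldr (prepend_inf arev) p (foldr (prepend_inf arev) q \<xi>)"
  using assms
proof (induction p arbitrary: u)
  case (Cons e p)
  then have "awalk (head G e) p v" by (simp add: awalk_Cons_iff)
  with Cons show ?case
    by (simp add: foldr_prepend_inf_prepend[OF awalk_path_mult])
qed simp

lemma group_action_boundary:
  assumes "v \<in> verts G"
  shows "group_action (fundamental_group G arev v) (boundary G arev v) (boundary_action G arev v)"
proof -
  let ?\<pi> = "fundamental_group G arev v" and ?B = "boundary G arev v"
    and ?\<phi> = "boundary_action G arev v"
  interpret group ?\<pi> using assms by (rule group_fundamental_group)
  have closed: "?\<phi> p \<xi> \<in> ?B" if "p \<in> carrier ?\<pi>" "\<xi> \<in> ?B" for p \<xi>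
    using that foldr_prepend_inf_boundary
    by (auto simp: boundary_action_def fundamental_group_def reduced_path_def)
  have mult: "?\<phi> (p \<otimes>\<^bsub>?\<pi>\<^esub> q) \<xi> = ?\<phi> p (?\<phi> q \<xi>)"
    if "p \<in> carrier ?\<pi>" "q \<in> carrier ?\<pi>" "\<xi> \<in> ?B" for p q \<xi>
  proof -
    have "awalk v p v" "awalk v q v"
      using that by (auto simp: fundamental_group_def reduced_path_def)
    with closed[OF that(2,3)] that show ?thesis
      by (simp add: boundary_action_def foldr_prepend_inf_path_mult)
        (simp add: fundamental_group_def foldr_prepend_inf_path_mult)
  qed
  have one: "?\<phi> \<one>\<^bsub>?\<pi>\<^esub> \<xi> = \<xi>" if "\<xi> \<in> ?B" for \<xi>
    using that by (simp add: boundary_action_def fundamental_group_def)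
  have Bij: "?\<phi> p \<in> Bij ?B" if p: "p \<in> carrier ?\<pi>" for p
  proof -
    have "bij_betw (?\<phi> p) ?B ?B"
    proof (rule bij_betw_byWitness[where f' = "?\<phi> (inv\<^bsub>?\<pi>\<^esub> p)"])
      show "\<forall>\<xi>\<in>?B. ?\<phi> (inv\<^bsub>?\<pi>\<^esub> p) (?\<phi> p \<xi>) = \<xi>" "\<forall>\<xi>\<in>?B. ?\<phi> p (?\<phi> (inv\<^bsub>?\<pi>\<^esub> p) \<xi>) = \<xi>"
        using p by (simp_all add: one flip: mult)
    qed (use p closed in auto)
    then show ?thesis by (simp add: Bij_def boundary_action_def)
  qed
  have "?\<phi> (p \<otimes>\<^bsub>?\<pi>\<^esub> q) = ?\<phi> p \<otimes>\<^bsub>BijGroup ?B\<^esub> ?\<phi> q"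
    if "p \<in> carrier ?\<pi>" "q \<in> carrier ?\<pi>" for p q
    using that mult Bij by (auto simp: BijGroup_def compose_def fun_eq_iff boundary_action_def)
  with Bij have "?\<phi> \<in> hom ?\<pi> (BijGroup ?B)"
    by (auto simp: hom_def BijGroup_def)
  then show ?thesis
    by (simp add: group_action_def group_hom_def group_hom_axioms_def group_BijGroup is_group)
qed

lemma reduced_path_prefix:
  assumes "\<xi> \<in> boundary G arev v"
  shows "reduced_path G arev v (prefix n \<xi>) (tail G (\<xi> n))"
  using assms
proof (induction n)
  case 0
  then show ?case
    by (auto simp: reduced_path_def boundary_def awalk_Nil_iff subsequence_def)
next
  case (Suc n)
  then have "reduced arev (prefix n \<xi> @ [\<xi> n])"
    by (cases n) (auto simp: reduced_path_def reduced_def successively_append_iff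
        boundary_def subsequence_def)
  with Suc show ?case
    by (auto simp: reduced_path_def awalk_append_iff awalk_Cons_iff awalk_Nil_iff boundary_def
        subsequence_def)
qed

lemma topspace_boundary_topology:
  assumes "v \<in> verts G"
  shows "topspace (boundary_topology G arev v) = boundary G arev v"
proof -
  have "reduced_path G arev v [] v"
    using assms by (simp add: reduced_path_def awalk_Nil_iff)
  then show ?thesis
    by (force simp: boundary_topology_def cylinder_def subsequence_def)
qed

text \<open>The cylinder sets form a base and not only a subbase of the topology.\<close>

lemma openin_boundary_topology:
  assumes "openin (boundary_topology G arev v) U" "\<xi> \<in> U"
  shows "\<exists>n. \<xi> \<in> cylinder G arev v (prefix n \<xi>) \<and> cylinder G arev v (prefix n \<xi>) \<subseteq> U"
proof -
  have mono: "cylinder G arev v (prefix n \<xi>) \<subseteq> cylinder G arev v (prefix m \<xi>)" if "m \<le> n" for m n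
    using that by (auto simp: cylinder_def subsequence_def)
  have self: "\<xi> \<in> cylinder G arev v (prefix n \<xi>)" if "\<xi> \<in> boundary G arev v" for n
    using that by (simp add: cylinder_def)
  have "generate_topology_on {cylinder G arev v \<mu> | \<mu> w. reduced_path G arev v \<mu> w} U"
    using assms(1) by (simp add: boundary_topology_def openin_topology_generated_by_iff)
  then show ?thesis using assms(2)
  proof (induction rule: generate_topology_on.induct)
    case (Int A B)
    then obtain m n where "\<xi> \<in> cylinder G arev v (prefix m \<xi>)"
      "cylinder G arev v (prefix m \<xi>) \<subseteq> A" "cylinder G arev v (prefix n \<xi>) \<subseteq> B"
      by auto
    with mono[of m "max m n"] mono[of n "max m n"] self show ?case
      by (intro exI[of _ "max m n"]) (auto simp: cylinder_def)
  next
    case (UN K)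
    then show ?case by blast
  next
    case (Basis S)
    then obtain \<mu> where "S = cylinder G arev v \<mu>" by auto
    with Basis self show ?case
      by (intro exI[of _ "length \<mu>"]) (auto simp: cylinder_def)
  qed simp
qed

end

end

theory Submission
  imports Defs
begin

text \<open>
  If an infinite path \<open>\<xi>\<close> is fixed by \<open>t \<noteq> 1\<close>, cancellation splits \<open>t = ac\<close> with
  \<open>\<xi> = c\<^sup>-\<^sup>1b = ab\<close>, and reducedness of \<open>t\<close> forces \<open>|a| \<noteq> |c|\<close>. So \<open>\<xi>\<close> is eventually periodic
  and determined by \<open>|c|\<close>, and \<open>t\<close> has only finitely many fixed points. If the fixed points
  contain a nonempty open set, some fixed \<open>\<xi>\<close> is therefore isolated; since every reduced path extends
  to an infinite one, \<open>\<xi>\<close> eventually meets no branching, and its periodic part closes up to a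
  minimal cycle that is a component of the graph. Conversely, in a minimal cycle every edge has a
  unique reduced continuation, so a cylinder of an edge is a single periodic point, fixed by its
  period.
\<close>

section \<open>Infinite words with two decompositions over the same tail\<close>

text \<open>Position \<open>length u + k\<close> of the common word lies in \<open>w\<close> or in
  \<open>b\<close> at an index below \<open>k\<close>, so \<open>u\<close> and \<open>w\<close>
  determine \<open>b\<close> letter by letter.\<close>

lemma conc_eq_unique:
  assumes "u \<frown> b = w \<frown> b" "u \<frown> b' = w \<frown> b'" "length u < length w"
  shows "b = b'"
proof
  fix k show "b k = b' k"
  proof (induction k rule: less_induct)
    case (less k)
    have "b k = (w \<frown> b) (length u + k)" "b' k = (w \<frown> b') (length u + k)"
      unfolding assms(1,2)[symmetric] by simp_all
    moreover have "(w \<frown> b) (length u + k) = (w \<frown> b') (length u + k)"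
      using less[of "length u + k - length w"] assms(3) by (auto simp: conc_def)
    ultimately show ?case by simp
  qed
qed

text \<open>Position \<open>length w + k\<close> reads \<open>b k\<close> through \<open>w\<close>
  and a later letter of \<open>b\<close> through the shorter \<open>u\<close>.\<close>

lemma conc_eq_periodic:
  assumes "u \<frown> b = w \<frown> b" "length u < length w"
  shows "b (k + (length w - length u)) = b k"
proof -
  have "b k = (w \<frown> b) (length w + k)" by simp
  also have "\<dots> = (u \<frown> b) (length w + k)" by (simp add: assms(1))
  finally show ?thesis using assms(2) by (simp add: conc_def add.commute)
qed

text \<open>Prefix neighbourhoods separate points; this isolates a fixed point from the finitely
  many others.\<close>

lemma finite_words_distinguished:
  assumes "finite F"
  shows "\<exists>n. \<forall>y\<in>F. prefix n y = prefix n \<xi> \<longrightarrow> y = \<xi>"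
  using assms
proof (induction F)
  case (insert y F)
  then obtain n where n: "\<forall>y\<in>F. prefix n y = prefix n \<xi> \<longrightarrow> y = \<xi>" by blast
  have mono: "prefix n z = prefix n \<xi>" if "prefix (max n m) z = prefix (max n m) \<xi>" for z m
    using that by (auto simp: subsequence_def)
  show ?case
  proof (cases "y = \<xi>")
    case False
    then obtain k where "y k \<noteq> \<xi> k" by blast
    then have "prefix (max n (Suc k)) y \<noteq> prefix (max n (Suc k)) \<xi>"
      by (auto simp: subsequence_def)
    with n mono show ?thesis by blast
  qed (use n in blast)
qed simp

section \<open>Non-backtracking continuation and infinite reduced paths\<close>

context bidirected_digraph
begin

text \<open>The non-backtracking relation on edges: boundary points are its infinite walks, and
  absence of branching means that \<open>f\<close> is unique.\<close>

definition follows :: "'b \<Rightarrow> 'b \<Rightarrow> bool" where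
  "follows e f \<longleftrightarrow> f \<in> arcs G \<and> tail G f = head G e \<and> f \<noteq> arev e"

lemma boundary_iff:
  "\<xi> \<in> boundary G arev v \<longleftrightarrow>
    tail G (\<xi> 0) = v \<and> \<xi> 0 \<in> arcs G \<and> (\<forall>n. follows (\<xi> n) (\<xi> (Suc n)))"
proof -
  have "\<xi> n \<in> arcs G" if "\<xi> 0 \<in> arcs G" "\<forall>n. follows (\<xi> n) (\<xi> (Suc n))" for n
    using that by (cases n) (auto simp: follows_def)
  then show ?thesis by (auto simp: boundary_def follows_def)
qed

lemma suffix_boundary: "\<xi> \<in> boundary G arev v \<Longrightarrow> suffix n \<xi> \<in> boundary G arev (tail G (\<xi> n))"
  by (auto simp: boundary_def)

text \<open>The edge \<open>arev e\<close> always leaves \<open>head G e\<close>, so a dead end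
  would give that vertex out-degree one.\<close>

lemma ex_follows:
  assumes "nonsingular G" "e \<in> arcs G"
  shows "\<exists>f. follows e f"
proof (rule ccontr)
  assume "\<not> ?thesis"
  then have "out_arcs G (head G e) = {arev e}"
    using assms(2) by (auto simp: follows_def)
  then have "out_degree G (head G e) = 1" by (simp add: out_degree_def)
  with assms show False by (simp add: nonsingular_def)
qed

text \<open>Reversal turns unique continuations into unique predecessors, which allows paths to be
  run backwards.\<close>

lemma follows_arev: "e \<in> arcs G \<Longrightarrow> follows e f \<Longrightarrow> follows (arev f) (arev e)"
  by (auto simp: follows_def)

lemma ex_boundary_from_arc:
  assumes "nonsingular G" "e \<in> arcs G"
  shows "\<exists>\<xi>\<in>boundary G arev (tail G e). \<xi> 0 = e"
proof -
  \<comment> \<open>One continuation is chosen for every edge; iterating \<open>g\<close> from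
    \<open>e\<close> gives the infinite path.\<close>
  obtain g where g: "\<And>e. e \<in> arcs G \<Longrightarrow> follows e (g e)"
    using ex_follows[OF assms(1)] by metis
  have "(g ^^ n) e \<in> arcs G" for n
    by (induction n) (use assms(2) g in \<open>auto simp: follows_def\<close>)
  with g assms(2) have "(\<lambda>n. (g ^^ n) e) \<in> boundary G arev (tail G e)"
    by (auto simp: boundary_iff)
  then show ?thesis by (rule bexI[rotated]) simp
qed

lemma boundary_conc:
  assumes "\<xi> \<in> boundary G arev v" "\<eta> \<in> boundary G arev (head G (\<xi> n))" "\<eta> 0 \<noteq> arev (\<xi> n)"
  shows "prefix (Suc n) \<xi> \<frown> \<eta> \<in> boundary G arev v"
proof -
  define \<zeta> where "\<zeta> = prefix (Suc n) \<xi> \<frown> \<eta>"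
  have eq: "\<zeta> k = (if k \<le> n then \<xi> k else \<eta> (k - Suc n))" for k
    by (auto simp: \<zeta>_def conc_def nth_append less_Suc_eq_le)
  have "follows (\<zeta> k) (\<zeta> (Suc k))" for k
  proof -
    \<comment> \<open>The joint is at \<open>k = n\<close>, where the condition on
      \<open>\<eta> 0\<close> rules out backtracking.\<close>
    consider "k < n" | "k = n" | "n < k" by linarith
    then show ?thesis
    proof cases
      case 3
      then have "Suc k - Suc n = Suc (k - Suc n)" by simp
      with 3 assms(2) show ?thesis unfolding eq boundary_iff by simp
    qed (use assms in \<open>unfold eq, auto simp: boundary_iff follows_def\<close>)
  qed
  with assms(1) have "\<zeta> \<in> boundary G arev v" by (simp add: boundary_iff eq)
  then show ?thesis by (simp only: \<zeta>_def)
qed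

text \<open>Nothing cancels because \<open>\<xi>\<close> is reduced. If
  \<open>suffix n \<xi> = \<xi>\<close>, this says that the period \<open>prefix n \<xi>\<close>
  fixes \<open>\<xi>\<close>.\<close>

lemma foldr_prepend_inf_prefix:
  assumes "\<xi> \<in> boundary G arev v"
  shows "foldr (prepend_inf arev) (prefix n \<xi>) (suffix n \<xi>) = \<xi>"
proof (induction n)
  case (Suc n)
  have "\<xi> (Suc n) \<noteq> arev (\<xi> n)" using assms by (simp add: boundary_def)
  moreover have "\<xi> n ## suffix (Suc n) \<xi> = suffix n \<xi>"
    using build_suffix_1[of "suffix n \<xi>"] by simp
  ultimately have "prepend_inf arev (\<xi> n) (suffix (Suc n) \<xi>) = suffix n \<xi>"
    by (simp add: prepend_inf_def del: suffix_nth) simp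
  moreover have "prefix (Suc n) \<xi> = prefix n \<xi> @ [\<xi> n]"
    by (simp add: subsequence_def)
  ultimately show ?case
    using Suc by (simp only: foldr_append foldr.simps o_apply id_apply)
qed (simp add: subsequence_def)

lemma boundary_action_apply:
  "\<xi> \<in> boundary G arev v \<Longrightarrow> boundary_action G arev v p \<xi> = foldr (prepend_inf arev) p \<xi>"
  by (simp add: boundary_action_def)

section \<open>Fixed points of a nontrivial group element\<close>

text \<open>For nonempty \<open>c\<close>, the edges \<open>arev (hd c)\<close> and
  \<open>hd c\<close> would meet at the junction.\<close>

lemma reduced_inverse_append_self:
  assumes "reduced arev (map arev (rev c) @ c)" "set c \<subseteq> arcs G"
  shows "c = []"
  using assms by (cases c) (auto simp: reduced_def successively_append_iff)

text \<open>Here \<open>i\<close> is the number of edges of \<open>p\<close> that cancel.\<close>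

lemma fixed_point_cases:
  assumes "reduced arev p" "set p \<subseteq> arcs G" "p \<noteq> []"
    and "foldr (prepend_inf arev) p \<xi> = \<xi>"
  obtains i u w b where "i \<le> length p"
    "u = take (length p - i) p" "w = map arev (rev (drop (length p - i) p))"
    "\<xi> = u \<frown> b" "u \<frown> b = w \<frown> b" "length u \<noteq> length w"
proof -
  obtain a c b where *: "p = a @ c" "\<xi> = map arev (rev c) \<frown> b" "\<xi> = a \<frown> b"
    using prepend_inf_cancels[OF assms(1), of \<xi>] assms(4) by metis
  \<comment> \<open>With equal lengths, \<open>a\<close> and the inverse of \<open>c\<close> are the
    same initial segment of \<open>\<xi>\<close>, so \<open>p\<close> is \<open>c\<close> preceded
    by its inverse; being reduced, it would be empty.\<close>
  have "length a \<noteq> length c"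
  proof
    assume len: "length a = length c"
    have "a = map arev (rev c)"
    proof (rule nth_equalityI)
      fix k assume "k < length a"
      then show "a ! k = map arev (rev c) ! k"
        using fun_cong[OF trans[OF *(3)[symmetric] *(2)], of k] len by (simp add: conc_def)
    qed (simp add: len)
    with * assms reduced_inverse_append_self[of c] show False by auto
  qed
  with * show ?thesis
    by (intro that[of "length c" a "map arev (rev c)" b]) auto
qed

text \<open>The words \<open>u\<close> and \<open>w\<close> depend only on \<open>p\<close> and the
  number \<open>i\<close> of cancelled edges, and they leave at most one tail \<open>b\<close>. So
  each \<open>i\<close> contributes at most one fixed point.\<close>

lemma fixed_points_finite:
  assumes "reduced arev p" "set p \<subseteq> arcs G" "p \<noteq> []"
  shows "finite {\<xi>. foldr (prepend_inf arev) p \<xi> = \<xi>}"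
proof -
  let ?u = "\<lambda>i. take (length p - i) p" and ?w = "\<lambda>i. map arev (rev (drop (length p - i) p))"
  define F where "F i = {?u i \<frown> b | b. ?u i \<frown> b = ?w i \<frown> b \<and> length (?u i) \<noteq> length (?w i)}"
    for i
  have "finite (F i)" for i
  proof -
    have "x = y" if "x \<in> F i" "y \<in> F i" for x y
    proof -
      obtain b b' where "x = ?u i \<frown> b" "?u i \<frown> b = ?w i \<frown> b" "y = ?u i \<frown> b'"
        "?u i \<frown> b' = ?w i \<frown> b'" "length (?u i) \<noteq> length (?w i)"
        using \<open>x \<in> F i\<close> \<open>y \<in> F i\<close> unfolding F_def by blast
      then show ?thesis
        using conc_eq_unique[of "?u i" b "?w i" b'] conc_eq_unique[of "?w i" b "?u i" b']
        by (metis linorder_neqE_nat)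
    qed
    then have "F i = {} \<or> (\<exists>x. F i = {x})" by blast
    then show ?thesis by auto
  qed
  moreover have "{\<xi>. foldr (prepend_inf arev) p \<xi> = \<xi>} \<subseteq> (\<Union>i\<le>length p. F i)"
  proof
    fix \<xi> assume "\<xi> \<in> {\<xi>. foldr (prepend_inf arev) p \<xi> = \<xi>}"
    then have "foldr (prepend_inf arev) p \<xi> = \<xi>" by simp
    from fixed_point_cases[OF assms this] obtain i u w b where
      "i \<le> length p" "u = ?u i" "w = ?w i" "\<xi> = u \<frown> b" "u \<frown> b = w \<frown> b" "length u \<noteq> length w" .
    then have "\<xi> \<in> F i" unfolding F_def by blast
    with \<open>i \<le> length p\<close> show "\<xi> \<in> (\<Union>i\<le>length p. F i)" by blast
  qed
  ultimately show ?thesis by (meson finite_UN_I finite_atMost finite_subset)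
qed

text \<open>The tail \<open>b\<close> has the difference of the lengths of \<open>u\<close> and
  \<open>w\<close> as a period, and it starts at position \<open>length u\<close>.\<close>

lemma fixed_point_eventually_periodic:
  assumes "reduced arev p" "set p \<subseteq> arcs G" "p \<noteq> []"
    and "foldr (prepend_inf arev) p \<xi> = \<xi>"
  shows "\<exists>d>0. \<exists>m. \<forall>k\<ge>m. \<xi> (k + d) = \<xi> k"
proof -
  from fixed_point_cases[OF assms] obtain u w b where
    *: "\<xi> = u \<frown> b" "u \<frown> b = w \<frown> b" "length u \<noteq> length w" by metis
  have "\<exists>d>0. \<forall>k. b (k + d) = b k"
  proof (cases "length u < length w")
    case True
    with conc_eq_periodic[OF *(2)] show ?thesis
      by (intro exI[of _ "length w - length u"]) auto
  next
    case False
    with * conc_eq_periodic[OF *(2)[symmetric]] show ?thesis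
      by (intro exI[of _ "length u - length w"]) auto
  qed
  then obtain d where d: "d > 0" "\<And>k. b (k + d) = b k" by blast
  have "\<xi> (k + d) = \<xi> k" if "k \<ge> length u" for k
    using that d(2)[of "k - length u"] by (simp add: *(1) conc_def)
  with d(1) show ?thesis by blast
qed

section \<open>Consequences of connectedness\<close>

text \<open>Every arc has an inverse, so connectedness makes each vertex reachable from
  \<open>x\<close> along directed arcs, and these never leave \<open>S\<close>.\<close>

lemma connected_closed_set:
  assumes "Digraph_Component.connected G" "x \<in> S" "S \<subseteq> verts G"
    and "\<And>e. e \<in> arcs G \<Longrightarrow> tail G e \<in> S \<Longrightarrow> head G e \<in> S"
  shows "verts G = S"
proof -
  have sc: "strongly_connected G"
    using symmetric_connected_imp_strongly_connected[OF sym_arcs assms(1)] .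
  have "y \<in> S" if "y \<in> verts G" for y
  proof -
    have "x \<rightarrow>\<^sup>*\<^bsub>G\<^esub> y" using sc assms that by (auto simp: strongly_connected_def)
    then show ?thesis
      by (induction rule: reachable_induct) (use assms in \<open>auto elim!: reachableE\<close>)
  qed
  with assms(3) show ?thesis by blast
qed

text \<open>Otherwise \<open>{v}\<close> is closed under arcs, hence is the whole vertex set, and
  any arc would start at \<open>v\<close>.\<close>

lemma ex_out_arc:
  assumes "Digraph_Component.connected G" "arcs G \<noteq> {}" "v \<in> verts G"
  shows "\<exists>e\<in>arcs G. tail G e = v"
proof (rule ccontr)
  assume "\<not> ?thesis"
  then have "verts G = {v}"
    using assms by (intro connected_closed_set[of v]) auto
  with assms(2) \<open>\<not> ?thesis\<close> show False
    using tail_in_verts by blast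
qed

section \<open>Minimal cycles have isolated periodic boundary points\<close>

text \<open>At most one edge of \<open>p\<close> and one edge outside \<open>p\<close> leave each
  vertex, which leaves no room for two continuations besides \<open>arev e\<close>.\<close>

lemma minimal_cycle_follows_unique:
  assumes p: "minimal_cycle G arev p" "arcs G = set p \<union> arev ` set p"
    and "e \<in> arcs G" "follows e f" "follows e f'"
  shows "f = f'"
proof -
  obtain u where u: "awalk u p u" "distinct (tl (awalk_verts u p))" "p \<noteq> []"
    using p by (auto simp: minimal_cycle_def cycle_def)
  then have "cas u p u" by (simp add: awalk_def)
  then have verts: "awalk_verts u p = tail G (hd p) # map (head G) p"
    using u(3) by (simp add: awalk_verts_conv')
  with u(2) have "distinct (map (head G) p)" by simp
  then have inj_head: "inj_on (head G) (set p)" by (simp add: distinct_map)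
  have ends: "tail G (hd p) = u" "head G (last p) = u"
    using \<open>cas u p u\<close> awlast_if_cas[OF \<open>cas u p u\<close>] u(3)
    by (simp_all add: cas_simp awalk_verts_conv)
  \<comment> \<open>Both lists are the vertex sequence of the closed walk; removing \<open>u\<close>
    from each as a multiset carries distinctness from heads to tails.\<close>
  have "map (tail G) p @ [u] = u # map (head G) p"
    using verts u(3) ends by (simp add: awalk_verts_conv)
  then have "mset (map (tail G) p @ [u]) = mset (u # map (head G) p)" by (simp only:)
  then have "mset (map (tail G) p) = mset (map (head G) p)" by simp
  with \<open>distinct (map (head G) p)\<close> have "distinct (map (tail G) p)"
    using mset_eq_imp_distinct_iff by blast
  then have inj_tail: "inj_on (tail G) (set p)" by (simp add: distinct_map)
  \<comment> \<open>Two edges of \<open>p\<close> are separated by their tails. Two edges outside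
    \<open>p\<close> are inverses of edges of \<open>p\<close>, whose heads separate them.\<close>
  have side: "g = g'"
    if "g \<in> arcs G" "g' \<in> arcs G" "tail G g = tail G g'" "g \<in> set p \<longleftrightarrow> g' \<in> set p" for g g'
  proof (cases "g \<in> set p")
    case True
    with that inj_tail show ?thesis by (auto dest: inj_onD)
  next
    case False
    with that have "g \<in> arev ` set p" "g' \<in> arev ` set p" unfolding p(2) by simp_all
    then obtain h h' where h: "h \<in> set p" "h' \<in> set p" "g = arev h" "g' = arev h'" by blast
    then have "h \<in> arcs G" "h' \<in> arcs G" unfolding p(2) by simp_all
    with h that(3) have "head G h = head G h'" by simp
    with h inj_head show ?thesis by (auto dest: inj_onD)
  qed
  \<comment> \<open>Pigeonhole: two of \<open>f\<close>, \<open>f'\<close>, \<open>arev e\<close>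
    agree on membership in \<open>p\<close>, and neither continuation equals
    \<open>arev e\<close>.\<close>
  show ?thesis
    using assms(3-5) side[of f f'] side[of f "arev e"] side[of f' "arev e"]
    by (auto simp: follows_def)
qed

text \<open>Finiteness forces an edge to repeat. Unique predecessors rewind the repetition to
  position 0, and unique continuations then make the path periodic from its start.\<close>

lemma periodic_boundary:
  assumes "nonsingular G" "finite (arcs G)" "e \<in> arcs G"
    and unique: "\<And>e f f'. e \<in> arcs G \<Longrightarrow> follows e f \<Longrightarrow> follows e f' \<Longrightarrow> f = f'"
  shows "\<exists>\<xi>\<in>boundary G arev (tail G e). \<exists>k>0. \<xi> 0 = e \<and> suffix k \<xi> = \<xi>"
proof -
  obtain \<xi> where \<xi>: "\<xi> \<in> boundary G arev (tail G e)" "\<xi> 0 = e"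
    using ex_boundary_from_arc assms by blast
  have arcs: "\<xi> n \<in> arcs G" for n using \<xi>(1) by (simp add: boundary_def)
  have step: "follows (\<xi> n) (\<xi> (Suc n))" for n using \<xi>(1) by (simp add: boundary_iff)
  have rewind: "m \<le> n \<Longrightarrow> \<xi> m = \<xi> n \<Longrightarrow> \<xi> 0 = \<xi> (n - m)" for m n
  proof (induction m arbitrary: n)
    case (Suc m)
    then obtain n' where n: "n = Suc n'" by (cases n) auto
    \<comment> \<open>Both are continuations of \<open>arev (\<xi> n)\<close>, since
      \<open>\<xi>\<close> takes the same value at \<open>Suc m\<close> and
      \<open>n\<close>.\<close>
    have "arev (\<xi> m) = arev (\<xi> n')"
      using unique[of "arev (\<xi> n)" "arev (\<xi> m)" "arev (\<xi> n')"] Suc.prems n arcs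
        follows_arev[OF arcs step]
      by (metis arev_in_arcs)
    with Suc n show ?case by (simp add: arev_eq_iff)
  qed simp
  have "\<not> inj \<xi>"
    using assms(2) arcs by (meson finite_subset image_subset_iff infinite_UNIV_nat finite_imageD)
  then obtain m n where mn: "m < n" "\<xi> m = \<xi> n"
    by (metis injI linorder_neqE_nat)
  let ?k = "n - m"
  have "\<xi> (?k + j) = \<xi> j" for j
  proof (induction j)
    case 0
    with mn rewind[of m n] show ?case by simp
  next
    case (Suc j)
    with unique[OF arcs[of j] step[of j]] step[of "?k + j"] show ?case by simp
  qed
  then have "suffix ?k \<xi> = \<xi>" by (auto simp: fun_eq_iff)
  with mn \<xi> show ?thesis by (intro bexI[of _ \<xi>] exI[of _ ?k]) auto
qed

lemma openin_cylinder:
  "reduced_path G arev v p w \<Longrightarrow> openin (boundary_topology G arev v) (cylinder G arev v p)"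
  unfolding boundary_topology_def by (rule topology_generated_by_Basis) blast

lemma minimal_cycle_not_topologically_free:
  assumes "Digraph_Component.connected G" "nonsingular G" "arcs G \<noteq> {}" "v \<in> verts G"
    and "is_minimal_cycle G arev"
  shows "\<not> topologically_free (fundamental_group G arev v) (boundary_topology G arev v)
    (boundary_action G arev v)"
proof
  let ?T = "boundary_topology G arev v" and ?\<phi> = "boundary_action G arev v"
  assume free: "topologically_free (fundamental_group G arev v) ?T ?\<phi>"
  obtain p where p: "minimal_cycle G arev p" "arcs G = set p \<union> arev ` set p"
    using assms(5) by (auto simp: is_minimal_cycle_def)
  obtain e where e: "e \<in> arcs G" "tail G e = v"
    using ex_out_arc assms by blast
  note unique = minimal_cycle_follows_unique[OF p]
  have "finite (arcs G)" by (simp add: p(2))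
  then have "\<exists>\<xi>\<in>boundary G arev (tail G e). \<exists>k>0. \<xi> 0 = e \<and> suffix k \<xi> = \<xi>"
    by (rule periodic_boundary[OF assms(2) _ e(1)]) (rule unique)
  then obtain \<xi> k where \<xi>: "\<xi> \<in> boundary G arev v" "k > 0" "\<xi> 0 = e" "suffix k \<xi> = \<xi>"
    using e(2) by blast
  let ?t = "prefix k \<xi>" and ?S = "{y \<in> topspace ?T. ?\<phi> (prefix k \<xi>) y \<noteq> y}"
  \<comment> \<open>The period closes up at \<open>v\<close> because the edge after it is again
    \<open>e\<close>; it is nontrivial because \<open>k > 0\<close>.\<close>
  have "\<xi> k = e" using \<xi>(3,4) by (metis add.right_neutral suffix_nth)
  then have "?t \<in> carrier (fundamental_group G arev v) - {\<one>\<^bsub>fundamental_group G arev v\<^esub>}"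
    using reduced_path_prefix[OF \<xi>(1), of k] \<xi>(2) e
    by (auto simp: fundamental_group_def subsequence_def)
  with free have "?T closure_of ?S = topspace ?T"
    unfolding topologically_free_def by blast
  moreover have "\<xi> \<in> topspace ?T"
    using \<xi>(1) topspace_boundary_topology assms(4) by simp
  ultimately have "\<xi> \<in> ?T closure_of ?S" by simp
  moreover have "openin ?T (cylinder G arev v (prefix 1 \<xi>))"
    using openin_cylinder reduced_path_prefix[OF \<xi>(1)] by blast
  moreover have "\<xi> \<in> cylinder G arev v (prefix 1 \<xi>)"
    using \<xi>(1) by (simp add: cylinder_def)
  ultimately obtain y where y: "y \<in> cylinder G arev v (prefix 1 \<xi>)" "?\<phi> ?t y \<noteq> y"
    unfolding in_closure_of by blast
  then have yb: "y \<in> boundary G arev v" and "y 0 = \<xi> 0"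
    by (auto simp: cylinder_def subsequence_def)
  \<comment> \<open>A moved point \<open>y\<close> in the cylinder of the first edge must copy
    \<open>\<xi>\<close> throughout, yet \<open>\<xi>\<close> is fixed.\<close>
  have "y n = \<xi> n" for n
  proof (induction n)
    case (Suc n)
    have "\<xi> n \<in> arcs G" using \<xi>(1) by (simp add: boundary_def)
    with unique[OF this, of "y (Suc n)" "\<xi> (Suc n)"] Suc \<xi>(1) yb
    show ?case unfolding boundary_iff by metis
  qed (fact \<open>y 0 = \<xi> 0\<close>)
  then have "y = \<xi>" by blast
  with y(2) \<xi> foldr_prepend_inf_prefix[OF \<xi>(1), of k] show False
    by (simp add: boundary_action_apply)
qed

section \<open>From isolated fixed points to a minimal cycle\<close>

text \<open>Leaving \<open>\<xi>\<close> along \<open>f\<close> after position \<open>m\<close> and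
  continuing forever gives a boundary point in the same cylinder, which can only be
  \<open>\<xi>\<close>.\<close>

lemma isolated_follows_unique:
  assumes "nonsingular G" "\<xi> \<in> boundary G arev v" "cylinder G arev v (prefix n \<xi>) \<subseteq> {\<xi>}"
    and "n \<le> m" "follows (\<xi> m) f"
  shows "f = \<xi> (Suc m)"
proof -
  have "f \<in> arcs G" "tail G f = head G (\<xi> m)" "f \<noteq> arev (\<xi> m)"
    using assms(5) by (auto simp: follows_def)
  with ex_boundary_from_arc[OF assms(1)] obtain \<eta> where
    \<eta>: "\<eta> \<in> boundary G arev (head G (\<xi> m))" "\<eta> 0 = f" by metis
  let ?y = "prefix (Suc m) \<xi> \<frown> \<eta>"
  have "?y \<in> boundary G arev v"
    using boundary_conc[OF assms(2) \<eta>(1)] \<eta>(2) \<open>f \<noteq> arev (\<xi> m)\<close> by simp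
  moreover have "prefix n ?y = prefix n \<xi>"
    using assms(4) by (auto simp: subsequence_def conc_def nth_append simp del: upt_Suc)
  ultimately have "?y = \<xi>" using assms(3) by (auto simp: cylinder_def)
  moreover have "?y (Suc m) = f" using \<eta>(2) by (simp add: conc_def)
  ultimately show ?thesis by simp
qed

text \<open>
  A shortest closed segment of \<open>\<xi>\<close> is a minimal cycle. No other edges touch its vertices, so it is
  everything by connectedness.
\<close>

lemma unbranched_closed_is_minimal_cycle:
  assumes "Digraph_Component.connected G" "\<xi> \<in> boundary G arev v"
    and unique: "\<And>k f. follows (\<xi> k) f \<Longrightarrow> f = \<xi> (Suc k)"
    and d: "d > 0" "tail G (\<xi> d) = v"
    and minimal: "\<And>i j. i < j \<Longrightarrow> j < i + d \<Longrightarrow> tail G (\<xi> i) \<noteq> tail G (\<xi> j)"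
  shows "is_minimal_cycle G arev"
proof -
  let ?p = "prefix d \<xi>"
  have arcs: "\<xi> k \<in> arcs G" and step: "head G (\<xi> k) = tail G (\<xi> (Suc k))"
    and red: "\<xi> (Suc k) \<noteq> arev (\<xi> k)" for k
    using assms(2) by (auto simp: boundary_def)
  have v: "tail G (\<xi> 0) = v" using assms(2) by (simp add: boundary_def)
  have path: "reduced_path G arev v ?p v"
    using reduced_path_prefix[OF assms(2), of d] d(2) by simp
  then have "awalk v ?p v" "cas v ?p v" by (auto simp: reduced_path_def awalk_def)
  \<comment> \<open>Heads are tails one position later; \<open>minimal\<close> bounds only the gap,
    so it also covers indices up to \<open>d\<close>.\<close>
  have "inj_on (\<lambda>k. head G (\<xi> k)) {..<d}"
  proof (rule inj_onI)
    fix i j assume ij: "i \<in> {..<d}" "j \<in> {..<d}" "head G (\<xi> i) = head G (\<xi> j)"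
    with step minimal[of "Suc i" "Suc j"] minimal[of "Suc j" "Suc i"] show "i = j"
      by (cases i j rule: linorder_cases) auto
  qed
  then have "distinct (tl (awalk_verts v ?p))"
    using \<open>cas v ?p v\<close> d(1)
    by (simp add: awalk_verts_conv' subsequence_def distinct_map comp_def lessThan_atLeast0)
  with path \<open>awalk v ?p v\<close> d(1) have cycle: "minimal_cycle G arev ?p"
    by (auto simp: minimal_cycle_def cycle_def reduced_path_def subsequence_def)
  have out: "f = arev (\<xi> k) \<or> f = \<xi> (Suc k)" if "f \<in> arcs G" "tail G f = tail G (\<xi> (Suc k))" for f k
    using unique[of k f] that step[of k] by (auto simp: follows_def)
  have set_p: "set ?p = \<xi> ` {..<d}" by (auto simp: subsequence_def)
  then have mem: "\<xi> k \<in> set ?p" if "k < d" for k using that by blast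
  obtain d' where d': "d = Suc d'" using d(1) by (cases d) auto
  have "\<xi> 0 = arev (\<xi> d') \<or> \<xi> 0 = \<xi> d"
    using out[of "\<xi> 0" d'] arcs d(2) v d' by simp
  \<comment> \<open>If the cycle closed by backtracking, its second vertex would recur at
    \<open>d'\<close>. Minimality leaves \<open>d' \<le> 1\<close>, where \<open>\<xi> 0\<close>
    would be its own inverse or \<open>\<xi>\<close> would not be reduced.\<close>
  moreover have "\<xi> 0 \<noteq> arev (\<xi> d')"
  proof
    assume eq: "\<xi> 0 = arev (\<xi> d')"
    then have "tail G (\<xi> 1) = tail G (\<xi> d')"
      using step[of 0] arcs[of d'] by simp
    with minimal[of 1 d'] d' have "d' \<le> 1" by force
    moreover have "d' \<noteq> 0" using eq arcs[of 0] arev_neq[of "\<xi> 0"] by metis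
    ultimately have "d' = 1" by simp
    with eq red[of 0] show False by simp
  qed
  ultimately have "\<xi> d = \<xi> 0" by simp
  \<comment> \<open>The fact \<open>out\<close> needs a preceding edge, so the vertex at position 0
    is treated as the one at position \<open>d\<close>.\<close>
  have touch: "f \<in> set ?p \<union> arev ` set ?p" if f: "f \<in> arcs G" "tail G f = tail G (\<xi> k)" "k < d" for f k
  proof (cases k)
    case 0
    with out[of f d'] f d' v d(2) \<open>\<xi> d = \<xi> 0\<close> have "f = arev (\<xi> d') \<or> f = \<xi> 0" by simp
    with mem[of 0] mem[of d'] d' show ?thesis by blast
  next
    case (Suc k')
    with out[of f k'] f have "f = arev (\<xi> k') \<or> f = \<xi> k" by simp
    with mem[of k] mem[of k'] Suc f(3) show ?thesis by auto
  qed
  let ?S = "(\<lambda>k. tail G (\<xi> k)) ` {..<d}"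
  have "tail G (\<xi> (Suc k)) \<in> ?S" if "k < d" for k
    using that d v by (cases "Suc k = d") (auto intro: image_eqI[of _ _ 0])
  then have heads: "head G f \<in> ?S" if "f \<in> set ?p \<union> arev ` set ?p" for f
    using that step arcs by (auto simp: set_p)
  have "verts G = ?S"
  proof (rule connected_closed_set[OF assms(1)])
    show "v \<in> ?S" using d(1) v by force
    show "?S \<subseteq> verts G" using arcs by auto
    fix e assume "e \<in> arcs G" "tail G e \<in> ?S"
    then have "e \<in> set ?p \<union> arev ` set ?p" using touch by blast
    then show "head G e \<in> ?S" by (rule heads)
  qed
  then have "f \<in> set ?p \<union> arev ` set ?p" if "f \<in> arcs G" for f
    using that touch[of f] tail_in_verts[OF that] by auto
  moreover have "set ?p \<union> arev ` set ?p \<subseteq> arcs G" using arcs by (auto simp: set_p)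
  ultimately have "arcs G = set ?p \<union> arev ` set ?p" by blast
  with cycle show ?thesis by (auto simp: is_minimal_cycle_def)
qed

text \<open>Some \<open>p\<close> fixes a nonempty open set pointwise; as its fixed points are
  finite in number, a small enough cylinder inside that set holds only one.\<close>

lemma not_topologically_free_isolated_fixed_point:
  assumes "v \<in> verts G"
    and "\<not> topologically_free (fundamental_group G arev v) (boundary_topology G arev v)
      (boundary_action G arev v)"
  obtains p \<xi> n where "reduced arev p" "set p \<subseteq> arcs G" "p \<noteq> []"
    "\<xi> \<in> boundary G arev v" "foldr (prepend_inf arev) p \<xi> = \<xi>"
    "cylinder G arev v (prefix n \<xi>) \<subseteq> {\<xi>}"
proof -
  let ?T = "boundary_topology G arev v" and ?\<phi> = "boundary_action G arev v"
  obtain p where p: "p \<in> carrier (fundamental_group G arev v)" "p \<noteq> []"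
    "?T closure_of {y \<in> topspace ?T. ?\<phi> p y \<noteq> y} \<noteq> topspace ?T"
    using assms(2) by (auto simp: topologically_free_def fundamental_group_def)
  then have red: "reduced arev p" "set p \<subseteq> arcs G"
    by (auto simp: fundamental_group_def reduced_path_def awalk_def)
  obtain \<xi> where "\<xi> \<in> topspace ?T" "\<xi> \<notin> ?T closure_of {y \<in> topspace ?T. ?\<phi> p y \<noteq> y}"
    using p(3) closure_of_subset_topspace[of ?T] by blast
  then obtain U where U: "openin ?T U" "\<xi> \<in> U" "\<And>y. y \<in> topspace ?T \<Longrightarrow> y \<in> U \<Longrightarrow> ?\<phi> p y = y"
    unfolding in_closure_of by blast
  then have fixed: "foldr (prepend_inf arev) p y = y" if "y \<in> boundary G arev v" "y \<in> U" for y
    using that assms(1) by (simp add: topspace_boundary_topology boundary_action_apply)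
  have \<xi>: "\<xi> \<in> boundary G arev v"
    using \<open>\<xi> \<in> topspace ?T\<close> assms(1) by (simp add: topspace_boundary_topology)
  obtain n where n: "cylinder G arev v (prefix n \<xi>) \<subseteq> U"
    using openin_boundary_topology[OF U(1,2)] by blast
  obtain m where m: "foldr (prepend_inf arev) p y = y \<Longrightarrow> prefix m y = prefix m \<xi> \<Longrightarrow> y = \<xi>" for y
    using finite_words_distinguished[OF fixed_points_finite[OF red p(2)], of \<xi>] by blast
  \<comment> \<open>Agreement up to \<open>n\<close> puts \<open>y\<close> into \<open>U\<close>,
    hence makes it fixed; agreement up to \<open>m\<close> then identifies it with
    \<open>\<xi>\<close>.\<close>
  have "y = \<xi>" if "y \<in> cylinder G arev v (prefix (max n m) \<xi>)" for y
  proof -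
    from that have y: "y \<in> boundary G arev v" "prefix n y = prefix n \<xi>" "prefix m y = prefix m \<xi>"
      by (auto simp: cylinder_def subsequence_def)
    with n have "y \<in> U" by (auto simp: cylinder_def)
    with fixed m y show ?thesis by blast
  qed
  then show ?thesis
    using that[OF red p(2) \<xi> fixed[OF \<xi> U(2)], of "max n m"] by blast
qed

lemma not_topologically_free_minimal_cycle:
  assumes "Digraph_Component.connected G" "nonsingular G" "v \<in> verts G"
    and "\<not> topologically_free (fundamental_group G arev v) (boundary_topology G arev v)
      (boundary_action G arev v)"
  shows "is_minimal_cycle G arev"
proof -
  obtain p \<xi> n where p: "reduced arev p" "set p \<subseteq> arcs G" "p \<noteq> []"
    and \<xi>: "\<xi> \<in> boundary G arev v" and fixed: "foldr (prepend_inf arev) p \<xi> = \<xi>"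
    and isolated: "cylinder G arev v (prefix n \<xi>) \<subseteq> {\<xi>}"
    using not_topologically_free_isolated_fixed_point assms(3,4) by metis
  \<comment> \<open>Gaps at which a vertex recurs beyond the depth \<open>n\<close> where branching
    stops. Eventual periodicity supplies one, and the least gap excludes repeated vertices within
    the segment.\<close>
  define returns where
    "returns d \<longleftrightarrow> d > 0 \<and> (\<exists>i\<ge>n. tail G (\<xi> (i + d)) = tail G (\<xi> i))" for d
  obtain d0 m where "d0 > 0" "\<forall>k\<ge>m. \<xi> (k + d0) = \<xi> k"
    using fixed_point_eventually_periodic[OF p fixed] by blast
  then have "returns d0" unfolding returns_def by (metis max.cobounded1 max.cobounded2)
  define d where "d = (LEAST d. returns d)"
  have "returns d" unfolding d_def using \<open>returns d0\<close> by (rule LeastI)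
  then obtain i where i: "d > 0" "n \<le> i" "tail G (\<xi> (i + d)) = tail G (\<xi> i)"
    by (auto simp: returns_def)
  have least: "d \<le> d'" if "returns d'" for d'
    unfolding d_def using that by (rule Least_le)
  show ?thesis
  \<comment> \<open>Dropping \<open>i \<ge> n\<close> edges moves the base point to
    \<open>tail G (\<xi> i)\<close> and leaves an unbranched path.\<close>
  proof (rule unbranched_closed_is_minimal_cycle[OF assms(1) suffix_boundary[OF \<xi>, of i]])
    show "f = suffix i \<xi> (Suc k)" if "follows (suffix i \<xi> k) f" for k f
      using isolated_follows_unique[OF assms(2) \<xi> isolated, of "i + k" f] that i(2) by simp
    show "tail G (suffix i \<xi> d) = tail G (\<xi> i)" using i(3) by simp
    show "tail G (suffix i \<xi> j) \<noteq> tail G (suffix i \<xi> k)" if "j < k" "k < j + d" for j k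
    proof
      assume "tail G (suffix i \<xi> j) = tail G (suffix i \<xi> k)"
      with that(1) i(2) have "returns (k - j)"
        unfolding returns_def by (intro conjI exI[of _ "i + j"]) auto
      with least that show False by fastforce
    qed
  qed (fact i(1))
qed

end

theorem theorem6p1:
  fixes \<Gamma> :: "('v, 'e) pre_digraph" and bar :: "'e \<Rightarrow> 'e" and v :: 'v
  assumes "bidirected_digraph \<Gamma> bar"
    and "countable (verts \<Gamma>)" and "countable (arcs \<Gamma>)"
    and "Digraph_Component.connected \<Gamma>"
    and "nonsingular \<Gamma>"
    and "locally_finite \<Gamma>"
    and "arcs \<Gamma> \<noteq> {}"
    and "v \<in> verts \<Gamma>"
  shows "topologically_free (fundamental_group \<Gamma> bar v) (boundary_topology \<Gamma> bar v)
           (boundary_action \<Gamma> bar v)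
         \<longleftrightarrow> \<not> is_minimal_cycle \<Gamma> bar"
proof -
  interpret bidirected_digraph \<Gamma> bar by fact
  show ?thesis
    using minimal_cycle_not_topologically_free not_topologically_free_minimal_cycle assms(4,5,7,8)
    by blast
qed

end
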